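(* Suppose the dynamics is input-affine, $f(x,u)=f_{\mathsf d}(x)+F_{\mathsf c}(x)u$ with $f_{\mathsf d}:\mathcal X\to\mathcal X$ and $F_{\mathsf c}:\mathcal X\to\mathbb R^{l\times m}$ continuous, and the reward is $r(x,u)=\mathfrak r(x)-\mathfrak c(u)$, where $\mathfrak r:\mathcal X\to\mathbb R$ is continuous, $\mathfrak c:\mathcal U\to\mathbb R$ is strictly convex and $\mathrm C^1$, and its gradient is surjective: $\nabla\mathfrak c(\mathcal U^{\mathrm o})=\mathbb R^{1\times m}$, with $\mathcal U^{\mathrm o}$ the interior of $\mathcal U$. Let $\langle v_i\rangle_{i\ge1}$ and $\langle\pi_i\rangle_{i\ge0}$ be generated by DPI or by IPI, starting from an admissible policy $\pi_0$ and under the boundary condition that, for every $i\in\mathbb N$, if $\pi_{i-1}$ is admissible then $\lim_{t\to\infty}\mathbb G_{\pi_{i-1}}^x[\gamma^tv_i(X_t)]=0$ for all $x\in\mathcal X$. Assume that $\langle\nabla v_i\rangle$ converges locally uniformly. Then $v_*=\hat v_*$, where $\hat v_*(x)=\sup_{i\in\mathbb N}v_i(x)$, is a solution of the Hamilton–Jacobi–Bellman equation $\alpha v_*(x)=\max_{u\in\mathcal U}h(x,u,\nabla v_*(x))$ for all $x\in\mathcal X$, such that $v_*\in\mathrm C^1$ and $$v_i\to v_*,\qquad\nabla v_i\to\nabla v_*,\qquad\pi_i\to\pi_*,$$ all locally uniformly, where $\pi_*(x)=\sigma\big(F_{\mathsf c}^{\mathsf T}(x)\nabla v_*^{\mathsf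 T}(x)\big)$ is the unique function satisfying $\pi_*(x)\in\arg\max_{u\in\mathcal U}h(x,u,\nabla v_*(x))$ for all $x$, and $\sigma=(\nabla\mathfrak c^{\mathsf T})^{-1}:\mathbb R^m\to\mathcal U^{\mathrm o}$ is the inverse of $\nabla\mathfrak c^{\mathsf T}:\mathcal U^{\mathrm o}\to\mathbb R^m$.
   Context: State space $\mathcal X=\mathbb R^l$, $\mathcal X^{\mathsf T}=\mathbb R^{1\times l}$, time space $\mathbb T=[0,\infty)$. The action space $\mathcal U\subseteq\mathbb R^m$ is an $m$-dimensional manifold with or without boundary, meaning $\mathcal U=O\cup\partial O$ or $\mathcal U=O$ for some open $O\subseteq\mathbb R^m$. The environment is $\dot X_t=f(X_t,U_t)$, with $f:\mathcal X\times\mathcal U\to\mathcal X$ continuous and $t\mapsto U_t\in\mathcal U$ continuous; it is a standing assumption that the state trajectory $t\mapsto X_t$ is uniquely defined over all of $\mathbb T$ (for every initial state, in particular under every policy). A policy is a continuous function $\pi:\mathcal X\to\mathcal U$. $\mathbb G_\pi^x[Y]$ denotes the value of $Y$ when $X_0=x$ and $U_t=\pi(X_t)$ for all $t\in\mathbb T$. The reward function $r:\mathcal X\times\mathcal U\to\mathbb R$ is continuous, $R_t=r(X_t,U_t)$; $\gamma\in(0,1]$ is the discount factor and $\alpha=-\ln\gamma\ge0$. Standing assumption: $r$ attains a maximum $r_{\mathsf{max}}$, and $r_{\mathsf{max}}=0$ if $\gamma=1$. The value function (VF) of $\pi$ is $v_\pi(x)=\mathbb G_\pi^x[\int_0^\infty\gamma^tR_t\,dt]\in[-\infty,\infty)$.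 A policy $\pi$ is admissible iff $v_\pi(x)$ is finite for all $x\in\mathcal X$. Standing assumption: at least one admissible policy exists, and every admissible VF is $\mathrm C^1$. Gradients are row vectors, and the Hamiltonian is $h(x,u,p)=r(x,u)+p\,f(x,u)$. A function on a set is $\mathrm C^1$ iff its first-order partial derivatives exist and are continuous over the interior of the set; strict convexity of $\mathfrak c$ on $\mathcal U$ includes convexity of $\mathcal U$. Under the hypotheses of the claim, $\nabla\mathfrak c^{\mathsf T}$ is a bijection $\mathcal U^{\mathrm o}\to\mathbb R^m$, its inverse $\sigma$ is continuous, and $\sigma(F_{\mathsf c}^{\mathsf T}(x)p^{\mathsf T})$ is the unique maximizer of $u\mapsto h(x,u,p)$ over $\mathcal U$. DPI (differential policy iteration): given an admissible policy $\pi_0$, for $i=1,2,\dots$: (evaluation) $v_i:\mathcal X\to\mathbb R$ is a $\mathrm C^1$ function with $\alpha v_i(x)=h(x,\pi_{i-1}(x),\nabla v_i(x))$ for all $x$; (improvement) $\pi_i$ is a policy with $\pi_i(x)\in\arg\max_{u\in\mathcal U}h(x,u,\nabla v_i(x))$ for all $x$, i.e., here $\pi_i(x)=\sigma(F_{\mathsf c}^{\mathsf T}(x)\nabla v_i^{\mathsf T}(x))$. IPI (integral policy iteration): the same except that, for a fixed $\eta>0$, evaluation requires a $\mathrm C^1$ function $v_i$ with $v_i(x)=\mathbb G_{\pi_{i-1}}^x[\int_0^\eta\gamma^tR_t\,dt+\gamma^\eta v_i(X_\eta)]$ for all $x$. Locally uniform convergence means each $x\in\mathcal X$ has a neighborhood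 on which convergence is uniform. *)

theory Defs
  imports "HOL-Analysis.Analysis"
begin

text \<open>
  Column vectors in \<open>\<real>\<^sup>l\<close> and row vectors in \<open>\<real>\<^sup>1\<^sup>\<times>\<^sup>l\<close> share the type \<^typ>\<open>real ^ 'l\<close>: the product of
  a row vector \<open>p\<close> and a column vector \<open>x\<close> is the inner product \<open>p \<bullet> x\<close>, and transposing a
  vector is invisible.  Functions on the action space \<open>U\<close> are total functions whose values
  outside \<open>U\<close> are never used.
\<close>

subsection \<open>Calculus and convexity\<close>

definition grad :: "(real ^ 'n \<Rightarrow> real) \<Rightarrow> real ^ 'n \<Rightarrow> real ^ 'n" where
  "grad g x = (\<chi> j. deriv (\<lambda>s. g (x + s *\<^sub>R axis j 1)) 0)"

definition C1_on :: "(real ^ 'n) set \<Rightarrow> (real ^ 'n \<Rightarrow> real) \<Rightarrow> bool" where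
  "C1_on S g \<longleftrightarrow>
     (\<forall>x\<in>interior S. \<forall>j. (\<lambda>s. g (x + s *\<^sub>R axis j 1)) differentiable (at 0)) \<and>
     continuous_on (interior S) (grad g)"

definition strictly_convex_on :: "(real ^ 'n) set \<Rightarrow> (real ^ 'n \<Rightarrow> real) \<Rightarrow> bool" where
  "strictly_convex_on S g \<longleftrightarrow> convex S \<and>
     (\<forall>x\<in>S. \<forall>y\<in>S. \<forall>t. x \<noteq> y \<longrightarrow> 0 < t \<longrightarrow> t < 1 \<longrightarrow>
        g ((1 - t) *\<^sub>R x + t *\<^sub>R y) < (1 - t) * g x + t * g y)"

definition is_maximum :: "('a \<Rightarrow> real) \<Rightarrow> 'a set \<Rightarrow> real \<Rightarrow> bool" where
  "is_maximum g S b \<longleftrightarrow> b \<in> g ` S \<and> (\<forall>y\<in>S. g y \<le> b)"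

definition locally_uniform_limit ::
  "(nat \<Rightarrow> 'a::topological_space \<Rightarrow> 'b::metric_space) \<Rightarrow> ('a \<Rightarrow> 'b) \<Rightarrow> bool" where
  "locally_uniform_limit g l \<longleftrightarrow>
     (\<forall>x. \<exists>N. open N \<and> x \<in> N \<and> uniform_limit N g l sequentially)"

subsection \<open>Environment and policies\<close>

definition action_space :: "(real ^ 'm) set \<Rightarrow> bool" where
  "action_space U \<longleftrightarrow> (\<exists>O'. open O' \<and> (U = O' \<union> frontier O' \<or> U = O'))"

definition policy :: "(real ^ 'm) set \<Rightarrow> (real ^ 'l \<Rightarrow> real ^ 'm) \<Rightarrow> bool" where
  "policy U p \<longleftrightarrow> continuous_on UNIV p \<and> (\<forall>x. p x \<in> U)"

text \<open>Trajectories live on \<open>[0,\<infinity>)\<close>; the derivative at time 0 is one-sided and values at negative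
  times are irrelevant.\<close>

definition state_trajectory ::
  "(real ^ 'l \<Rightarrow> real ^ 'm \<Rightarrow> real ^ 'l) \<Rightarrow> real ^ 'l \<Rightarrow> (real \<Rightarrow> real ^ 'm) \<Rightarrow> (real \<Rightarrow> real ^ 'l) \<Rightarrow> bool"
  where
  "state_trajectory f x a X \<longleftrightarrow> X 0 = x \<and>
     (\<forall>t\<ge>0. (X has_vector_derivative f (X t) (a t)) (at t within {0..}))"

definition policy_trajectory ::
  "(real ^ 'l \<Rightarrow> real ^ 'm \<Rightarrow> real ^ 'l) \<Rightarrow> (real ^ 'l \<Rightarrow> real ^ 'm) \<Rightarrow> real ^ 'l \<Rightarrow> (real \<Rightarrow> real ^ 'l) \<Rightarrow> bool"
  where
  "policy_trajectory f p x X \<longleftrightarrow> state_trajectory f x (\<lambda>t. p (X t)) X"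

definition unique_trajectory :: "((real \<Rightarrow> real ^ 'l) \<Rightarrow> bool) \<Rightarrow> bool" where
  "unique_trajectory T \<longleftrightarrow> (\<exists>X. T X \<and> (\<forall>Y. T Y \<longrightarrow> (\<forall>t\<ge>0. Y t = X t)))"

text \<open>The first conjunct concerns prescribed continuous action signals, the second one actions
  generated in feedback by a policy; neither implies the other.\<close>

definition well_posed ::
  "(real ^ 'l \<Rightarrow> real ^ 'm \<Rightarrow> real ^ 'l) \<Rightarrow> (real ^ 'm) set \<Rightarrow> bool" where
  "well_posed f U \<longleftrightarrow>
     (\<forall>x a. continuous_on {0..} a \<and> a ` {0..} \<subseteq> U \<longrightarrow> unique_trajectory (state_trajectory f x a)) \<and>
     (\<forall>x p. policy U p \<longrightarrow> unique_trajectory (policy_trajectory f p x))"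

definition traj ::
  "(real ^ 'l \<Rightarrow> real ^ 'm \<Rightarrow> real ^ 'l) \<Rightarrow> (real ^ 'l \<Rightarrow> real ^ 'm) \<Rightarrow> real ^ 'l \<Rightarrow> real \<Rightarrow> real ^ 'l"
  where
  "traj f p x = (SOME X. policy_trajectory f p x X)"

subsection \<open>Value functions and the Hamiltonian\<close>

definition discounted_reward ::
  "(real ^ 'l \<Rightarrow> real ^ 'm \<Rightarrow> real ^ 'l) \<Rightarrow> (real ^ 'l \<Rightarrow> real ^ 'm \<Rightarrow> real) \<Rightarrow> real \<Rightarrow>
   (real ^ 'l \<Rightarrow> real ^ 'm) \<Rightarrow> real ^ 'l \<Rightarrow> real \<Rightarrow> real" where
  "discounted_reward f r \<gamma> p x b =
     integral {0..b} (\<lambda>t. \<gamma> powr t * r (traj f p x t) (p (traj f p x t)))"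

text \<open>The integral over \<open>[0,\<infinity>)\<close> is the limit of the integrals over \<open>[0,b]\<close>.  It exists in
  \<open>[-\<infinity>,\<infinity>)\<close> because \<open>\<gamma>\<^sup>t R\<^sub>t\<close> is bounded above by \<open>\<gamma>\<^sup>t r\<^sub>m\<^sub>a\<^sub>x\<close>, and \<open>r\<^sub>m\<^sub>a\<^sub>x = 0\<close> if \<open>\<gamma> = 1\<close>.\<close>

definition value_function ::
  "(real ^ 'l \<Rightarrow> real ^ 'm \<Rightarrow> real ^ 'l) \<Rightarrow> (real ^ 'l \<Rightarrow> real ^ 'm \<Rightarrow> real) \<Rightarrow> real \<Rightarrow>
   (real ^ 'l \<Rightarrow> real ^ 'm) \<Rightarrow> real ^ 'l \<Rightarrow> ereal" where
  "value_function f r \<gamma> p x = Lim at_top (\<lambda>b. ereal (discounted_reward f r \<gamma> p x b))"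

definition admissible ::
  "(real ^ 'l \<Rightarrow> real ^ 'm \<Rightarrow> real ^ 'l) \<Rightarrow> (real ^ 'l \<Rightarrow> real ^ 'm \<Rightarrow> real) \<Rightarrow> (real ^ 'm) set \<Rightarrow> real \<Rightarrow>
   (real ^ 'l \<Rightarrow> real ^ 'm) \<Rightarrow> bool" where
  "admissible f r U \<gamma> p \<longleftrightarrow> policy U p \<and> (\<forall>x. \<bar>value_function f r \<gamma> p x\<bar> \<noteq> \<infinity>)"

definition hamiltonian ::
  "(real ^ 'l \<Rightarrow> real ^ 'm \<Rightarrow> real ^ 'l) \<Rightarrow> (real ^ 'l \<Rightarrow> real ^ 'm \<Rightarrow> real) \<Rightarrow>
   real ^ 'l \<Rightarrow> real ^ 'm \<Rightarrow> real ^ 'l \<Rightarrow> real" where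
  "hamiltonian f r x u q = r x u + q \<bullet> f x u"

subsection \<open>Policy iteration\<close>

text \<open>The sequence \<open>v\<close> starts at index 1; \<open>v 0\<close> is unconstrained.\<close>

definition policy_improvement ::
  "(real ^ 'l \<Rightarrow> real ^ 'm \<Rightarrow> real ^ 'l) \<Rightarrow> (real ^ 'l \<Rightarrow> real ^ 'm \<Rightarrow> real) \<Rightarrow> (real ^ 'm) set \<Rightarrow>
   (real ^ 'l \<Rightarrow> real) \<Rightarrow> (real ^ 'l \<Rightarrow> real ^ 'm) \<Rightarrow> bool" where
  "policy_improvement f r U w p \<longleftrightarrow> policy U p \<and>
     (\<forall>x. is_arg_max (\<lambda>u. hamiltonian f r x u (grad w x)) (\<lambda>u. u \<in> U) (p x))"

definition DPI ::
  "(real ^ 'l \<Rightarrow> real ^ 'm \<Rightarrow> real ^ 'l) \<Rightarrow> (real ^ 'l \<Rightarrow> real ^ 'm \<Rightarrow> real) \<Rightarrow> (real ^ 'm) set \<Rightarrow> real \<Rightarrow>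
   (nat \<Rightarrow> real ^ 'l \<Rightarrow> real) \<Rightarrow> (nat \<Rightarrow> real ^ 'l \<Rightarrow> real ^ 'm) \<Rightarrow> bool" where
  "DPI f r U \<gamma> v \<pi> \<longleftrightarrow> admissible f r U \<gamma> (\<pi> 0) \<and>
     (\<forall>i\<ge>1. C1_on UNIV (v i) \<and>
        (\<forall>x. - ln \<gamma> * v i x = hamiltonian f r x (\<pi> (i - 1) x) (grad (v i) x)) \<and>
        policy_improvement f r U (v i) (\<pi> i))"

definition IPI ::
  "(real ^ 'l \<Rightarrow> real ^ 'm \<Rightarrow> real ^ 'l) \<Rightarrow> (real ^ 'l \<Rightarrow> real ^ 'm \<Rightarrow> real) \<Rightarrow> (real ^ 'm) set \<Rightarrow> real \<Rightarrow>
   real \<Rightarrow> (nat \<Rightarrow> real ^ 'l \<Rightarrow> real) \<Rightarrow> (nat \<Rightarrow> real ^ 'l \<Rightarrow> real ^ 'm) \<Rightarrow> bool" where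
  "IPI f r U \<gamma> \<eta> v \<pi> \<longleftrightarrow> admissible f r U \<gamma> (\<pi> 0) \<and>
     (\<forall>i\<ge>1. C1_on UNIV (v i) \<and>
        (\<forall>x. v i x = discounted_reward f r \<gamma> (\<pi> (i - 1)) x \<eta>
                       + \<gamma> powr \<eta> * v i (traj f (\<pi> (i - 1)) x \<eta>)) \<and>
        policy_improvement f r U (v i) (\<pi> i))"

end

theory Submission
  imports Defs
begin

text \<open>
  Along a trajectory \<open>X\<^sub>t\<close> of a policy \<open>p\<close>, the function
  \<open>t \<mapsto> \<integral>\<^sub>0\<^sup>t \<gamma>\<^sup>s R\<^sub>s ds + \<gamma>\<^sup>t w(X\<^sub>t)\<close> has derivative
  \<open>\<gamma>\<^sup>t (h(X\<^sub>t, p(X\<^sub>t), \<nabla>w(X\<^sub>t)) - \<alpha> w(X\<^sub>t))\<close>.  For \<open>p = \<pi>\<^sub>i\<^sub>-\<^sub>1\<close>, \<open>w = v\<^sub>i\<close> it is constant, so the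
  boundary condition identifies \<open>v\<^sub>i\<close> with the value function of \<open>\<pi>\<^sub>i\<^sub>-\<^sub>1\<close>, and DPI and IPI evaluate
  policies alike.  For \<open>p = \<pi>\<^sub>i\<close>, \<open>w = v\<^sub>i\<close> it is nondecreasing, so \<open>\<pi>\<^sub>i\<close> is again admissible and
  \<open>v\<^sub>i \<le> v\<^sub>i\<^sub>+\<^sub>1\<close>.  Hence \<open>v\<^sub>i\<close> increases to a finite limit, which inherits the limit of the gradients
  as its gradient.  By strict convexity \<open>\<nabla>\<cc>\<close> is injective, and invariance of domain makes its
  inverse \<open>\<sigma>\<close> continuous; this carries the convergence over to the policies, and
  \<open>\<alpha> v\<^sub>i\<^sub>+\<^sub>1(x) = h(x, \<pi>\<^sub>i(x), \<nabla>v\<^sub>i\<^sub>+\<^sub>1(x))\<close> passes to the limit.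
\<close>

subsection \<open>Functions of class C1 and strict convexity\<close>

text \<open>\<open>C1_on\<close> differentiates at parameter 0 only; moving the base point along the
  axis covers every parameter \<open>t\<close>.\<close>

lemma C1_on_partial_derivative:
  assumes "C1_on S g" "x + t *\<^sub>R axis j 1 \<in> interior S"
  shows "((\<lambda>s. g (x + s *\<^sub>R axis j 1)) has_real_derivative grad g (x + t *\<^sub>R axis j 1) $ j) (at t)"
proof -
  have "(\<lambda>s. g ((x + t *\<^sub>R axis j 1) + s *\<^sub>R axis j 1)) differentiable (at 0)"
    using assms by (auto simp: C1_on_def)
  then have "((\<lambda>s. g ((x + t *\<^sub>R axis j 1) + s *\<^sub>R axis j 1)) has_real_derivative
      grad g (x + t *\<^sub>R axis j 1) $ j) (at 0)"
    by (simp add: grad_def flip: DERIV_deriv_iff_real_differentiable)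
  also have "(\<lambda>s. g ((x + t *\<^sub>R axis j 1) + s *\<^sub>R axis j 1)) = (\<lambda>s. g (x + (s + t) *\<^sub>R axis j 1))"
    by (simp add: algebra_simps)
  finally show ?thesis
    using DERIV_shift[of "\<lambda>s. g (x + s *\<^sub>R axis j 1)" _ 0 t] by simp
qed

text \<open>Induction on the set of coordinates in which the increment is allowed to be nonzero.\<close>

lemma C1_on_increment_bound:
  assumes C1: "C1_on S g" and x: "x \<in> interior S" and "finite J" and "0 < e"
  shows "\<exists>d>0. \<forall>y h. dist y x < d \<longrightarrow> norm h < d \<longrightarrow> (\<forall>j. j \<notin> J \<longrightarrow> h $ j = 0) \<longrightarrow>
           \<bar>g (y + h) - g y - grad g x \<bullet> h\<bar> \<le> e * norm h"
  using \<open>finite J\<close> \<open>0 < e\<close>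
proof (induction J arbitrary: e)
  case empty
  have "\<bar>g (y + h) - g y - grad g x \<bullet> h\<bar> \<le> e * norm h" if "\<forall>j. j \<notin> {} \<longrightarrow> h $ j = 0" for y h
  proof -
    have "h = 0" using that by (simp add: vec_eq_iff)
    then show ?thesis by simp
  qed
  then show ?case using zero_less_one by blast
next
  case (insert j J)
  obtain d1 where d1: "d1 > 0" and IH: "\<And>y h. dist y x < d1 \<Longrightarrow> norm h < d1 \<Longrightarrow>
      (\<forall>j. j \<notin> J \<longrightarrow> h $ j = 0) \<Longrightarrow> \<bar>g (y + h) - g y - grad g x \<bullet> h\<bar> \<le> e / 2 * norm h"
    using insert.IH[of "e / 2"] insert.prems by auto
  obtain d2 where d2: "d2 > 0" "ball x d2 \<subseteq> interior S"
    using x open_contains_ball[of "interior S"] by auto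
  have "continuous_on (interior S) (grad g)" using C1 by (simp add: C1_on_def)
  then obtain d3 where d3: "d3 > 0"
    and near: "\<And>z. z \<in> interior S \<Longrightarrow> dist z x < d3 \<Longrightarrow> dist (grad g z) (grad g x) < e / 2"
    using x insert.prems unfolding continuous_on_iff by (metis half_gt_zero)
  \<comment> \<open>The points met below differ from \<open>x\<close> by at most
    \<open>norm (y - x) + norm h' + \<bar>s\<bar>\<close>, a sum of three terms each below
    \<open>d\<close>.\<close>
  define d where "d = min d1 (min d2 d3 / 3)"
  have "\<bar>g (y + h) - g y - grad g x \<bullet> h\<bar> \<le> e * norm h"
    if y: "dist y x < d" and h: "norm h < d" and supp: "\<forall>k. k \<notin> insert j J \<longrightarrow> h $ k = 0" for y h
  proof -
    \<comment> \<open>\<open>h'\<close> drops coordinate \<open>j\<close>, so the move from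
      \<open>y\<close> to \<open>y + h\<close> splits into one covered by the induction hypothesis
      and one along a single axis. Each contributes half of the error.\<close>
    define h' where "h' = h - h $ j *\<^sub>R axis j 1"
    have h'_nth: "h' $ k = (if k = j then 0 else h $ k)" for k
      by (simp add: h'_def axis_def)
    have norm_h': "norm h' \<le> norm h"
      by (rule norm_le_componentwise_cart) (simp add: h'_nth)
    have h_eq: "h = h' + h $ j *\<^sub>R axis j 1" by (simp add: h'_def)
    have near': "y + h' + s *\<^sub>R axis j 1 \<in> interior S \<and>
        \<bar>grad g (y + h' + s *\<^sub>R axis j 1) $ j - grad g x $ j\<bar> \<le> e / 2" if s: "s \<in> {- norm h..norm h}" for s
    proof -
      let ?z = "y + h' + s *\<^sub>R axis j 1"
      have "dist ?z x = norm ((y - x) + h' + s *\<^sub>R axis j 1)" by (simp add: dist_norm algebra_simps)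
      also have "\<dots> \<le> norm (y - x) + norm h' + \<bar>s\<bar>"
        by (intro norm_triangle_le add_mono) auto
      also have "\<dots> < 3 * d" using y h norm_h' s by (auto simp: dist_norm)
      finally have z: "dist ?z x < d2" "dist ?z x < d3" by (auto simp: d_def)
      then have S: "?z \<in> interior S" using d2 by (auto simp: dist_commute)
      have "\<bar>(grad g ?z - grad g x) $ j\<bar> \<le> norm (grad g ?z - grad g x)" by (rule component_le_norm_cart)
      also have "\<dots> \<le> e / 2" using near[OF S z(2)] by (simp add: dist_norm)
      finally show ?thesis using S by simp
    qed
    \<comment> \<open>Subtracting the linear term makes the derivative of \<open>?\<phi>\<close> a
      difference of partial derivatives, which is small, so the mean value inequality
      applies.\<close>
    let ?\<phi> = "\<lambda>s. g (y + h' + s *\<^sub>R axis j 1) - s * grad g x $ j"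
    have "norm (?\<phi> (h $ j) - ?\<phi> 0) \<le> e / 2 * norm (h $ j - 0)"
    proof (rule field_differentiable_bound[of "{- norm h..norm h}"])
      fix s assume s: "s \<in> {- norm h..norm h}"
      show "(?\<phi> has_field_derivative grad g (y + h' + s *\<^sub>R axis j 1) $ j - grad g x $ j)
          (at s within {- norm h..norm h})"
        by (rule has_field_derivative_at_within, rule DERIV_diff,
            rule C1_on_partial_derivative[OF C1])
           (use near'[OF s] in \<open>auto intro!: derivative_eq_intros\<close>)
      show "norm (grad g (y + h' + s *\<^sub>R axis j 1) $ j - grad g x $ j) \<le> e / 2"
        using near'[OF s] by simp
    qed (use component_le_norm_cart[of h j] in auto)
    then have step: "\<bar>g (y + h) - g (y + h') - h $ j * grad g x $ j\<bar> \<le> e / 2 * \<bar>h $ j\<bar>"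
      by (subst h_eq) (simp add: add.assoc algebra_simps)
    have "\<bar>g (y + h') - g y - grad g x \<bullet> h'\<bar> \<le> e / 2 * norm h'"
      by (rule IH) (use y h norm_h' supp in \<open>auto simp: d_def h'_nth\<close>)
    moreover have "grad g x \<bullet> h = grad g x \<bullet> h' + h $ j * grad g x $ j"
      by (subst h_eq) (simp add: inner_add_right cart_eq_inner_axis inner_commute)
    ultimately have "\<bar>g (y + h) - g y - grad g x \<bullet> h\<bar> \<le> e / 2 * norm h' + e / 2 * \<bar>h $ j\<bar>"
      using step by linarith
    also have "\<dots> \<le> e / 2 * norm h + e / 2 * norm h"
      using insert.prems norm_h' component_le_norm_cart[of h j] by (intro add_mono mult_left_mono) auto
    finally show ?thesis by simp
  qed
  moreover have "d > 0" using d1 d2 d3 by (simp add: d_def)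
  ultimately show ?case by blast
qed

text \<open>The increment bound with all coordinates allowed and \<open>y = x\<close>. It turns
  partial derivatives into a total derivative, as the chain rule along trajectories
  requires.\<close>

lemma C1_on_has_derivative:
  assumes "C1_on S g" "x \<in> interior S"
  shows "(g has_derivative (\<lambda>h. grad g x \<bullet> h)) (at x)"
  unfolding has_derivative_at_alt
proof (intro conjI allI impI)
  show "bounded_linear (\<lambda>h. grad g x \<bullet> h)" by (rule bounded_linear_inner_right)
  fix e :: real assume "0 < e"
  from C1_on_increment_bound[OF assms finite[of UNIV] this]
  obtain d where "d > 0"
    and d: "\<And>y h. dist y x < d \<Longrightarrow> norm h < d \<Longrightarrow> \<bar>g (y + h) - g y - grad g x \<bullet> h\<bar> \<le> e * norm h"
    by auto
  show "\<exists>d>0. \<forall>y. norm (y - x) < d \<longrightarrow>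
      norm (g y - g x - grad g x \<bullet> (y - x)) \<le> e * norm (y - x)"
    using \<open>d > 0\<close> d[of x "_ - x"] by (intro exI[of _ d]) auto
qed

lemma has_derivative_partial:
  assumes "(g has_derivative (\<lambda>h. q \<bullet> h)) (at x)"
  shows "((\<lambda>s. g (x + s *\<^sub>R axis j 1)) has_real_derivative q $ j) (at 0)"
proof -
  have "((\<lambda>s. x + s *\<^sub>R axis j 1) has_derivative (\<lambda>s. s *\<^sub>R axis j 1)) (at 0)"
    by (auto intro!: derivative_eq_intros)
  from has_derivative_compose[OF this, of g "\<lambda>h. q \<bullet> h"] assms
  show ?thesis
    by (simp add: has_field_derivative_def inner_axis mult_commute_abs)
qed

lemma has_derivative_imp_grad_eq:
  assumes "(g has_derivative (\<lambda>h. q \<bullet> h)) (at x)"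
  shows "grad g x = q"
  using has_derivative_partial[OF assms] by (simp add: grad_def vec_eq_iff DERIV_imp_deriv)

lemma C1_onI:
  assumes "\<And>x. (g has_derivative (\<lambda>h. G x \<bullet> h)) (at x)" and "continuous_on UNIV G"
  shows "C1_on UNIV g"
proof -
  have "grad g = G" using assms(1) has_derivative_imp_grad_eq by blast
  then show ?thesis
    using has_derivative_partial[OF assms(1)] assms(2)
    by (auto simp: C1_on_def real_differentiable_def)
qed

text \<open>Difference quotients along a segment from \<open>u\<close> give the tangent inequality
  without strictness. Used at the midpoint of \<open>u\<close> and \<open>w\<close>, where strict
  convexity leaves a gap, it becomes strict. The point \<open>w\<close> may lie on the boundary of
  \<open>U\<close>.\<close>

lemma strictly_convex_on_grad_less:
  assumes cvx: "strictly_convex_on U c" and C1: "C1_on U c"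
    and u: "u \<in> interior U" and w: "w \<in> U" "w \<noteq> u"
  shows "c u + grad c u \<bullet> (w - u) < c w"
proof -
  have uU: "u \<in> U" using u interior_subset by blast
  have less: "c ((1 - t) *\<^sub>R u + t *\<^sub>R z) < (1 - t) * c u + t * c z"
    if "0 < t" "t < 1" "z \<in> U" "z \<noteq> u" for t z
    using cvx[unfolded strictly_convex_on_def, THEN conjunct2, rule_format, OF uU \<open>z \<in> U\<close> _ that(1,2)]
      that(4) by auto
  have segment: "(1 - t) *\<^sub>R u + t *\<^sub>R z = u + t *\<^sub>R (z - u)" for t z
    by (simp add: algebra_simps)
  have le: "grad c u \<bullet> (z - u) \<le> c z - c u" if z: "z \<in> U" "z \<noteq> u" for z
  proof (rule tendsto_upperbound)
    have "((\<lambda>t. u + t *\<^sub>R (z - u)) has_derivative (\<lambda>t. t *\<^sub>R (z - u))) (at 0)"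
      by (auto intro!: derivative_eq_intros)
    from has_derivative_compose[OF this, of c "\<lambda>h. grad c u \<bullet> h"] C1_on_has_derivative[OF C1 u]
    have "((\<lambda>t. c (u + t *\<^sub>R (z - u))) has_real_derivative grad c u \<bullet> (z - u)) (at 0)"
      by (simp add: has_field_derivative_def mult_commute_abs)
    then have "((\<lambda>t. (c (u + t *\<^sub>R (z - u)) - c u) / t) \<longlongrightarrow> grad c u \<bullet> (z - u)) (at 0)"
      by (simp add: DERIV_def)
    then show "((\<lambda>t. (c (u + t *\<^sub>R (z - u)) - c u) / t) \<longlongrightarrow> grad c u \<bullet> (z - u)) (at_right 0)"
      by (rule tendsto_within_subset) simp
    have "(c (u + t *\<^sub>R (z - u)) - c u) / t \<le> c z - c u" if t: "0 < t" "t < 1" for t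
    proof -
      have "c (u + t *\<^sub>R (z - u)) - c u < t * (c z - c u)"
        using less[OF t z] by (simp add: segment left_diff_distrib right_diff_distrib)
      then show ?thesis using t by (simp add: divide_le_eq mult.commute)
    qed
    then show "\<forall>\<^sub>F t in at_right 0. (c (u + t *\<^sub>R (z - u)) - c u) / t \<le> c z - c u"
      unfolding eventually_at_right_field by (intro exI[of _ 1]) auto
  qed simp
  define m where "m = (1 - 1 / 2) *\<^sub>R u + (1 / 2 :: real) *\<^sub>R w"
  have m_u: "m - u = (1 / 2) *\<^sub>R (w - u)" unfolding m_def segment by simp
  have "m \<in> U"
    unfolding m_def by (rule convexD_alt) (use cvx uU w in \<open>simp_all add: strictly_convex_on_def\<close>)
  moreover have "m \<noteq> u" using m_u w by auto
  ultimately have "grad c u \<bullet> (m - u) \<le> c m - c u" by (rule le)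
  moreover have "c m < 1 / 2 * c u + 1 / 2 * c w"
    using less[of "1 / 2" w] w by (simp add: m_def)
  ultimately show ?thesis by (simp add: m_u)
qed

text \<open>With equal gradients, the strict tangent inequalities at \<open>u\<close> and at
  \<open>w\<close> add up to a contradiction.\<close>

lemma strictly_convex_on_inj_on_grad:
  assumes "strictly_convex_on U c" and "C1_on U c"
  shows "inj_on (grad c) (interior U)"
proof (rule inj_onI, rule ccontr)
  fix u w assume *: "u \<in> interior U" "w \<in> interior U" "grad c u = grad c w" "u \<noteq> w"
  then have U: "u \<in> U" "w \<in> U" using interior_subset by blast+
  have "c u + grad c u \<bullet> (w - u) < c w" "c w + grad c u \<bullet> (u - w) < c u"
    using strictly_convex_on_grad_less[OF assms *(1) U(2)] strictly_convex_on_grad_less[OF assms *(2) U(1)] *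
    by auto
  then show False unfolding inner_diff_right by linarith
qed

lemma strictly_convex_on_bij_betw_grad:
  assumes "strictly_convex_on U c" and "C1_on U c" and "grad c ` interior U = UNIV"
  shows "bij_betw (grad c) (interior U) UNIV"
  using strictly_convex_on_inj_on_grad[OF assms(1,2)] assms(3) by (simp add: bij_betw_def)

text \<open>Invariance of domain: a continuous injection of the open set \<open>interior U\<close>
  into a space of the same dimension has a continuous inverse.\<close>

lemma continuous_on_inv_grad:
  assumes "strictly_convex_on U c" and "C1_on U c" and "grad c ` interior U = UNIV"
  shows "continuous_on UNIV (inv_into (interior U) (grad c))"
  unfolding assms(3)[symmetric]
proof (rule continuous_on_inverse_open)
  show "continuous_on (interior U) (grad c)" using assms(2) by (simp add: C1_on_def)
  show "inv_into (interior U) (grad c) (grad c u) = u" if "u \<in> interior U" for u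
    using that strictly_convex_on_inj_on_grad[OF assms(1,2)] by simp
qed auto

text \<open>Up to a term free of \<open>u\<close>, the Hamiltonian is
  \<open>(transpose (Fc x) *v q) \<bullet> u - c u\<close>. Where \<open>grad c\<close> matches that
  vector, the strict tangent inequality beats every other action, boundary actions included.\<close>

lemma input_affine_is_arg_max_iff:
  fixes f :: "real ^ 'l \<Rightarrow> real ^ 'm \<Rightarrow> real ^ 'l"
  assumes f: "\<And>u. u \<in> U \<Longrightarrow> f x u = fd x + Fc x *v u"
    and r: "\<And>u. u \<in> U \<Longrightarrow> r x u = rr x - c u"
    and c: "strictly_convex_on U c" "C1_on U c" "grad c ` interior U = UNIV"
  shows "is_arg_max (\<lambda>u. hamiltonian f r x u q) (\<lambda>u. u \<in> U) u \<longleftrightarrow>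
    u = inv_into (interior U) (grad c) (transpose (Fc x) *v q)"
proof -
  define u0 where "u0 = inv_into (interior U) (grad c) (transpose (Fc x) *v q)"
  have u0: "u0 \<in> interior U" "grad c u0 = transpose (Fc x) *v q"
    using c(3) by (auto simp: u0_def inv_into_into f_inv_into_f)
  then have "u0 \<in> U" using interior_subset by blast
  have dot: "q \<bullet> (Fc x *v w) = grad c u0 \<bullet> w" for w
    by (simp add: u0(2) dot_lmul_matrix)
  have less: "hamiltonian f r x w q < hamiltonian f r x u0 q" if "w \<in> U" "w \<noteq> u0" for w
    using strictly_convex_on_grad_less[OF c(1,2) u0(1) that] \<open>w \<in> U\<close> \<open>u0 \<in> U\<close>
    by (simp add: hamiltonian_def f r inner_add_right inner_diff_right dot)
  then show ?thesis
    using \<open>u0 \<in> U\<close> unfolding is_arg_max_linorder u0_def[symmetric]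
    by (metis less_imp_le linorder_not_less order_refl)
qed

subsection \<open>Locally uniform convergence\<close>

lemma locally_uniform_limit_imp_tendsto:
  assumes "locally_uniform_limit F G"
  shows "(\<lambda>i. F i x) \<longlonglongrightarrow> G x"
  using assms unfolding locally_uniform_limit_def by (blast intro: tendsto_uniform_limitI)

text \<open>Finitely many terms may differ: the initial policy is given freely and need not have the
  form of the later ones.\<close>

lemma locally_uniform_limit_cong:
  assumes lim: "locally_uniform_limit F G" and eq: "\<forall>\<^sub>F i in sequentially. F i = F' i"
  shows "locally_uniform_limit F' G"
  unfolding locally_uniform_limit_def
proof
  fix x
  obtain N where N: "open N" "x \<in> N" "uniform_limit N F G sequentially"
    using lim unfolding locally_uniform_limit_def by blast
  have "uniform_limit N F' G sequentially"
    using eq by (intro uniform_limit_cong[THEN iffD1, OF _ _ N(3)]) (auto elim!: eventually_mono)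
  with N show "\<exists>N. open N \<and> x \<in> N \<and> uniform_limit N F' G sequentially" by blast
qed

lemma locally_uniform_limit_continuous:
  fixes F :: "nat \<Rightarrow> 'a::t2_space \<Rightarrow> 'b::metric_space"
  assumes lim: "locally_uniform_limit F G" and cont: "\<forall>\<^sub>F i in sequentially. continuous_on UNIV (F i)"
  shows "continuous_on UNIV G"
proof -
  have "isCont G x" for x
  proof -
    obtain N where N: "open N" "x \<in> N" "uniform_limit N F G sequentially"
      using lim unfolding locally_uniform_limit_def by blast
    have "continuous_on N G"
      by (rule uniform_limit_theorem[OF _ N(3)])
         (use cont in \<open>auto elim!: eventually_mono intro: continuous_on_subset\<close>)
    with N show ?thesis by (simp add: continuous_on_eq_continuous_at)
  qed
  then show ?thesis by (simp add: continuous_on_eq_continuous_at)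
qed

text \<open>On a closed ball \<open>G\<close> is bounded, so the \<open>F i\<close> eventually take
  values in one compact set, on which \<open>\<Phi>\<close> is uniformly continuous.\<close>

lemma locally_uniform_limit_compose:
  fixes F :: "nat \<Rightarrow> 'a::euclidean_space \<Rightarrow> 'b::euclidean_space" and \<Phi> :: "'a \<times> 'b \<Rightarrow> 'c::metric_space"
  assumes lim: "locally_uniform_limit F G" and G: "continuous_on UNIV G" and \<Phi>: "continuous_on UNIV \<Phi>"
  shows "locally_uniform_limit (\<lambda>i x. \<Phi> (x, F i x)) (\<lambda>x. \<Phi> (x, G x))"
  unfolding locally_uniform_limit_def
proof
  fix x
  obtain N where N: "open N" "x \<in> N" "uniform_limit N F G sequentially"
    using lim unfolding locally_uniform_limit_def by blast
  then obtain d where d: "d > 0" "cball x d \<subseteq> N" using open_contains_cball by blast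
  have "bounded (G ` cball x d)"
    by (intro compact_imp_bounded compact_continuous_image continuous_on_subset[OF G]) auto
  then obtain B where B: "\<And>y. y \<in> cball x d \<Longrightarrow> norm (G y) \<le> B" unfolding bounded_iff by blast
  \<comment> \<open>The margin 1 in the radius leaves room for \<open>F i y\<close>, which is
    eventually within \<open>min \<delta> 1\<close> of \<open>G y\<close>.\<close>
  have uc: "uniformly_continuous_on (cball x d \<times> cball 0 (B + 1)) \<Phi>"
    by (intro compact_uniformly_continuous continuous_on_subset[OF \<Phi>] compact_Times) auto
  have "uniform_limit (cball x d) (\<lambda>i y. \<Phi> (y, F i y)) (\<lambda>y. \<Phi> (y, G y)) sequentially"
  proof (rule uniform_limitI)
    fix e :: real assume "0 < e"
    with uc obtain \<delta> where \<delta>: "\<delta> > 0" and close: "\<And>p q. p \<in> cball x d \<times> cball 0 (B + 1) \<Longrightarrow>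
        q \<in> cball x d \<times> cball 0 (B + 1) \<Longrightarrow> dist p q < \<delta> \<Longrightarrow> dist (\<Phi> p) (\<Phi> q) < e"
      unfolding uniformly_continuous_on_def by metis
    have "\<forall>\<^sub>F i in sequentially. \<forall>y\<in>cball x d. dist (F i y) (G y) < min \<delta> 1"
      using uniform_limit_on_subset[OF N(3) d(2)] \<delta> by (intro uniform_limitD) auto
    then show "\<forall>\<^sub>F i in sequentially. \<forall>y\<in>cball x d. dist (\<Phi> (y, F i y)) (\<Phi> (y, G y)) < e"
    proof eventually_elim
      case (elim i)
      show ?case
      proof
        fix y assume y: "y \<in> cball x d"
        have "norm (F i y) \<le> norm (G y) + dist (F i y) (G y)"
          unfolding dist_norm by (metis add.commute diff_add_cancel norm_triangle_ineq)
        then have "norm (F i y) \<le> B + 1" using elim y B[OF y] by force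
        then show "dist (\<Phi> (y, F i y)) (\<Phi> (y, G y)) < e"
          using elim y B[OF y] by (intro close) (simp_all add: dist_Pair_Pair)
      qed
    qed
  qed
  then show "\<exists>N. open N \<and> x \<in> N \<and> uniform_limit N (\<lambda>i y. \<Phi> (y, F i y)) (\<lambda>y. \<Phi> (y, G y)) sequentially"
    using d(1) by (intro exI[of _ "ball x d"]) (auto intro: uniform_limit_on_subset)
qed

text \<open>Termwise differentiation on balls. Convexity of the ball and uniform convergence of the
  gradients make the differences of two late functions Lipschitz with a small constant; convergence
  at the centre then gives uniform convergence of the functions.\<close>

lemma locally_uniform_limit_grad:
  fixes w :: "nat \<Rightarrow> real ^ 'n \<Rightarrow> real"
  assumes C1: "\<And>i. i \<ge> 1 \<Longrightarrow> C1_on UNIV (w i)"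
    and lim: "locally_uniform_limit (\<lambda>i. grad (w i)) G"
    and pt: "\<And>x. (\<lambda>i. w i x) \<longlonglongrightarrow> z x"
  shows "locally_uniform_limit w z" and "(z has_derivative (\<lambda>h. G x \<bullet> h)) (at x)"
proof -
  have deriv: "(w (Suc i) has_derivative (\<lambda>h. grad (w (Suc i)) x \<bullet> h)) (at x)" for i x
    by (rule C1_on_has_derivative[OF C1]) auto
  have "\<exists>d>0. (z has_derivative (\<lambda>h. G x \<bullet> h)) (at x) \<and> uniform_limit (ball x d) w z sequentially" for x
  proof -
    obtain N where N: "open N" "x \<in> N" "uniform_limit N (\<lambda>i. grad (w i)) G sequentially"
      using lim unfolding locally_uniform_limit_def by blast
    then obtain d where d: "d > 0" "ball x d \<subseteq> N" using open_contains_ball by blast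
    \<comment> \<open>The shift by \<open>Suc\<close> skips index 0, where no smoothness is
      assumed.\<close>
    have ul: "uniform_limit (ball x d) (\<lambda>i. grad (w (Suc i))) G sequentially"
      using uniform_limit_on_subset[OF N(3) d(2)]
      by (rule filterlim_sequentially_Suc[THEN iffD2])
    have nle: "\<forall>\<^sub>F n in sequentially. \<forall>y\<in>ball x d. \<forall>h.
        norm (grad (w (Suc n)) y \<bullet> h - G y \<bullet> h) \<le> e * norm h" if "e > 0" for e
      using uniform_limitD[OF ul that]
    proof eventually_elim
      case (elim n)
      show ?case
      proof (intro ballI allI)
        fix y h assume "y \<in> ball x d"
        then have "norm (grad (w (Suc n)) y - G y) \<le> e" using elim by (force simp: dist_norm)
        then show "norm (grad (w (Suc n)) y \<bullet> h - G y \<bullet> h) \<le> e * norm h"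
          unfolding inner_diff_left[symmetric] real_norm_def
          by (meson Cauchy_Schwarz_ineq2 mult_right_mono norm_ge_zero order_trans)
      qed
    qed
    have derw: "\<And>n y. y \<in> ball x d \<Longrightarrow>
        (w (Suc n) has_derivative (\<lambda>h. grad (w (Suc n)) y \<bullet> h)) (at y within ball x d)"
      using deriv has_derivative_at_withinI by blast
    have ptS: "(\<lambda>n. w (Suc n) y) \<longlonglongrightarrow> z y" for y using pt by (rule LIMSEQ_Suc)
    obtain k where k: "\<And>y. y \<in> ball x d \<Longrightarrow> (\<lambda>n. w (Suc n) y) \<longlonglongrightarrow> k y \<and>
        (k has_derivative (\<lambda>h. G y \<bullet> h)) (at y within ball x d)"
    proof -
      have "\<exists>k. \<forall>y\<in>ball x d. (\<lambda>n. w (Suc n) y) \<longlonglongrightarrow> k y \<and>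
          (k has_derivative (\<lambda>h. G y \<bullet> h)) (at y within ball x d)"
        by (rule has_derivative_sequence[where ?x0.0 = x, OF convex_ball derw nle _ ptS]) (use d(1) in simp_all)
      then show ?thesis using that by blast
    qed
    have kz: "k y = z y" if "y \<in> ball x d" for y
      using k[OF that] ptS LIMSEQ_unique by blast
    have "(z has_derivative (\<lambda>h. G x \<bullet> h)) (at x within ball x d)"
      by (rule has_derivative_transform[of x _ _ k]) (use k[of x] kz d(1) in simp_all)
    then have D: "(z has_derivative (\<lambda>h. G x \<bullet> h)) (at x)"
      using at_within_open[of x "ball x d"] d(1) by simp
    have "uniform_limit (ball x d) (\<lambda>n. w (Suc n)) z sequentially"
    proof (rule uniform_limitI)
      fix e :: real assume "0 < e"
      \<comment> \<open>Over the radius \<open>d\<close> this Lipschitz constant costs at most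
        \<open>e / 4\<close>; the error at the centre adds less than \<open>e / 2\<close>.\<close>
      define \<epsilon> where "\<epsilon> = e / (4 * d)"
      have "\<epsilon> > 0" using \<open>0 < e\<close> d(1) by (simp add: \<epsilon>_def)
      obtain M where M: "\<And>m n y y'. m \<ge> M \<Longrightarrow> n \<ge> M \<Longrightarrow> y \<in> ball x d \<Longrightarrow> y' \<in> ball x d \<Longrightarrow>
          norm ((w (Suc m) y - w (Suc n) y) - (w (Suc m) y' - w (Suc n) y')) \<le> \<epsilon> * norm (y - y')"
      proof -
        have "\<exists>M. \<forall>m\<ge>M. \<forall>n\<ge>M. \<forall>y\<in>ball x d. \<forall>y'\<in>ball x d.
            norm ((w (Suc m) y - w (Suc n) y) - (w (Suc m) y' - w (Suc n) y')) \<le> \<epsilon> * norm (y - y')"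
          by (rule has_derivative_sequence_Lipschitz[OF convex_ball derw nle \<open>\<epsilon> > 0\<close>])
        then show ?thesis using that by blast
      qed
      \<comment> \<open>The Lipschitz estimate against the centre, with the second index sent to
        infinity.\<close>
      have bound: "\<bar>(w (Suc m) y - z y) - (w (Suc m) x - z x)\<bar> \<le> e / 4"
        if "m \<ge> M" and y: "y \<in> ball x d" for m y
      proof (rule tendsto_upperbound)
        show "(\<lambda>n. \<bar>(w (Suc m) y - w (Suc n) y) - (w (Suc m) x - w (Suc n) x)\<bar>)
            \<longlonglongrightarrow> \<bar>(w (Suc m) y - z y) - (w (Suc m) x - z x)\<bar>"
          by (intro tendsto_intros ptS)
        have "\<epsilon> * norm (y - x) \<le> \<epsilon> * d"
          using y \<open>\<epsilon> > 0\<close> by (intro mult_left_mono) (auto simp: dist_norm norm_minus_commute)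
        also have "\<dots> = e / 4" using d(1) by (simp add: \<epsilon>_def)
        finally have "\<epsilon> * norm (y - x) \<le> e / 4" .
        moreover have "\<bar>(w (Suc m) y - w (Suc n) y) - (w (Suc m) x - w (Suc n) x)\<bar> \<le> \<epsilon> * norm (y - x)"
          if "n \<ge> M" for n
          using M[OF \<open>m \<ge> M\<close> that y, of x] d(1) by simp
        ultimately show "\<forall>\<^sub>F n in sequentially.
            \<bar>(w (Suc m) y - w (Suc n) y) - (w (Suc m) x - w (Suc n) x)\<bar> \<le> e / 4"
          by (intro eventually_sequentiallyI[of M]) (rule order_trans)
      qed simp
      have "\<forall>\<^sub>F m in sequentially. dist (w (Suc m) x) (z x) < e / 2"
        using ptS \<open>0 < e\<close> by (intro tendstoD) auto
      then show "\<forall>\<^sub>F m in sequentially. \<forall>y\<in>ball x d. dist (w (Suc m) y) (z y) < e"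
        using eventually_ge_at_top[of M]
      proof eventually_elim
        case (elim m)
        show ?case
        proof
          fix y assume "y \<in> ball x d"
          from bound[OF elim(2) this] elim(1) \<open>0 < e\<close>
          show "dist (w (Suc m) y) (z y) < e" unfolding dist_real_def by linarith
        qed
      qed
    qed
    then have "uniform_limit (ball x d) w z sequentially"
      by (rule filterlim_sequentially_Suc[THEN iffD1])
    with D d(1) show ?thesis by blast
  qed
  then show "locally_uniform_limit w z" and "(z has_derivative (\<lambda>h. G x \<bullet> h)) (at x)"
    unfolding locally_uniform_limit_def by (meson centre_in_ball open_ball)+
qed

subsection \<open>Policy evaluation and improvement\<close>

text \<open>The derivative at time 0 is one-sided, so the argument uses two-sided derivatives in the
  open interval and mere continuity at its ends.\<close>

lemma nonneg_derivative_imp_mono: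
  fixes g :: "real \<Rightarrow> real"
  assumes "\<And>t. t \<ge> 0 \<Longrightarrow> (g has_real_derivative g' t) (at t within {0..})"
    and "\<And>t. t \<ge> 0 \<Longrightarrow> 0 \<le> g' t" and "0 \<le> s" "s \<le> t"
  shows "g s \<le> g t"
proof (rule DERIV_nonneg_imp_increasing_open[OF \<open>s \<le> t\<close>])
  show "\<exists>y. DERIV g u :> y \<and> y \<ge> 0" if "s < u" "u < t" for u
  proof -
    have "at u within {0..} = at u"
      using that \<open>0 \<le> s\<close> by (intro at_within_interior) auto
    then show ?thesis using assms(1,2)[of u] that \<open>0 \<le> s\<close> by force
  qed
  have "continuous_on {0..} g"
    using assms(1) by (auto simp: continuous_on_eq_continuous_within intro: DERIV_continuous)
  then show "continuous_on {s..t} g" by (rule continuous_on_subset) (use \<open>0 \<le> s\<close> in auto)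
qed

lemma antimono_bounded_tendsto:
  fixes g :: "real \<Rightarrow> real"
  assumes anti: "\<And>s t. 0 \<le> s \<Longrightarrow> s \<le> t \<Longrightarrow> g t \<le> g s" and bound: "\<And>t. 0 \<le> t \<Longrightarrow> B \<le> g t"
  shows "\<exists>L. (g \<longlongrightarrow> L) at_top"
proof
  have bdd: "bdd_below (g ` {0..})" by (rule bdd_belowI2[of _ B]) (use bound in auto)
  show "(g \<longlongrightarrow> Inf (g ` {0..})) at_top"
  proof (rule decreasing_tendsto)
    show "\<forall>\<^sub>F t in at_top. Inf (g ` {0..}) \<le> g t"
      using eventually_ge_at_top[of 0] by eventually_elim (auto intro: cInf_lower bdd)
    fix a assume "Inf (g ` {0..}) < a"
    then obtain s where s: "0 \<le> s" "g s < a" using cInf_less_iff[OF _ bdd] by auto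
    show "\<forall>\<^sub>F t in at_top. g t < a"
      using eventually_ge_at_top[of s] by eventually_elim (use s anti in force)
  qed
qed

lemma tendsto_imp_value_function:
  assumes "(discounted_reward f r \<gamma> p x \<longlongrightarrow> L) at_top"
  shows "value_function f r \<gamma> p x = ereal L"
  unfolding value_function_def using assms by (intro tendsto_Lim) auto

text \<open>The constant \<open>\<kappa>\<close> is \<open>r\<^sub>m\<^sub>a\<^sub>x / \<alpha>\<close>, the largest conceivable value, if \<open>\<gamma> < 1\<close>, and \<open>0\<close> if \<open>\<gamma> = 1\<close>.\<close>

locale control_problem =
  fixes f :: "real ^ 'l \<Rightarrow> real ^ 'm \<Rightarrow> real ^ 'l" and r :: "real ^ 'l \<Rightarrow> real ^ 'm \<Rightarrow> real"
    and U :: "(real ^ 'm) set" and \<gamma> \<kappa> :: real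
  assumes r_cont: "continuous_on (UNIV \<times> U) (\<lambda>(x, u). r x u)"
    and well_posed: "well_posed f U"
    and \<gamma>_pos: "0 < \<gamma>"
    and r_le: "u \<in> U \<Longrightarrow> r x u \<le> - ln \<gamma> * \<kappa>"
    and \<kappa>_tendsto: "((\<lambda>t. \<gamma> powr t * \<kappa>) \<longlongrightarrow> 0) at_top"
begin

abbreviation "disc \<equiv> discounted_reward f r \<gamma>"
abbreviation "X \<equiv> traj f"
abbreviation "ham \<equiv> hamiltonian f r"

lemma powr_deriv: "((\<lambda>t. \<gamma> powr t) has_real_derivative ln \<gamma> * \<gamma> powr t) (at t within S)"
  using \<gamma>_pos unfolding powr_def by (auto intro!: derivative_eq_intros)

lemma traj_policy_trajectory:
  assumes "policy U p" shows "policy_trajectory f p x (X p x)"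
  using well_posed assms unfolding well_posed_def unique_trajectory_def traj_def
  by (metis someI_ex)

lemma traj_0: "policy U p \<Longrightarrow> X p x 0 = x"
  using traj_policy_trajectory by (auto simp: policy_trajectory_def state_trajectory_def)

lemma traj_deriv:
  "policy U p \<Longrightarrow> t \<ge> 0 \<Longrightarrow> (X p x has_vector_derivative f (X p x t) (p (X p x t))) (at t within {0..})"
  using traj_policy_trajectory by (auto simp: policy_trajectory_def state_trajectory_def)

lemma traj_cont: "policy U p \<Longrightarrow> continuous_on {0..} (X p x)"
  using traj_deriv has_vector_derivative_continuous
  by (force simp: continuous_on_eq_continuous_within)

text \<open>Semigroup property: the closed loop is autonomous, so the shifted trajectory solves the
  same equation from \<open>X p x s\<close>, and uniqueness applies.\<close>

lemma traj_add:
  assumes p: "policy U p" and "0 \<le> s" "0 \<le> t"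
  shows "X p x (s + t) = X p (X p x s) t"
proof -
  let ?Y = "\<lambda>t. X p x (s + t)"
  have "(?Y has_vector_derivative f (?Y t) (p (?Y t))) (at t within {0..})" if "t \<ge> 0" for t
  proof -
    have "((\<lambda>t. s + t) has_vector_derivative 1) (at t within {0..})"
      by (auto intro!: derivative_eq_intros)
    moreover have "(X p x has_vector_derivative f (?Y t) (p (?Y t))) (at (s + t) within (\<lambda>t. s + t) ` {0..})"
      by (rule has_vector_derivative_within_subset[OF traj_deriv[OF p]]) (use assms that in auto)
    ultimately show ?thesis
      using vector_diff_chain_within[of "\<lambda>t. s + t" 1 t "{0..}" "X p x"] by (simp add: o_def)
  qed
  then have "policy_trajectory f p (X p x s) ?Y"
    by (simp add: policy_trajectory_def state_trajectory_def)
  moreover have "unique_trajectory (policy_trajectory f p (X p x s))"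
    using well_posed p by (simp add: well_posed_def)
  ultimately show ?thesis
    using traj_policy_trajectory[OF p] \<open>0 \<le> t\<close> unfolding unique_trajectory_def by metis
qed

lemma reward_cont:
  assumes p: "policy U p"
  shows "continuous_on {0..} (\<lambda>t. \<gamma> powr t * r (X p x t) (p (X p x t)))"
proof -
  have "continuous_on {0..} (\<lambda>t. p (X p x t))"
    using p by (intro continuous_on_compose2[OF _ traj_cont[OF p]]) (auto simp: policy_def)
  then have "continuous_on {0..} (\<lambda>t. (X p x t, p (X p x t)))"
    by (intro continuous_on_Pair traj_cont[OF p])
  from continuous_on_compose2[OF r_cont this]
  have "continuous_on {0..} (\<lambda>t. r (X p x t) (p (X p x t)))" using p by (auto simp: policy_def)
  then show ?thesis using \<gamma>_pos by (intro continuous_intros) auto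
qed

lemma disc_deriv:
  assumes p: "policy U p" and "t \<ge> 0"
  shows "(disc p x has_real_derivative \<gamma> powr t * r (X p x t) (p (X p x t))) (at t within {0..})"
proof -
  have "(disc p x has_vector_derivative \<gamma> powr t * r (X p x t) (p (X p x t))) (at t within {0..t + 1})"
    unfolding discounted_reward_def
    by (rule integral_has_vector_derivative[OF continuous_on_subset[OF reward_cont[OF p]]])
       (use \<open>t \<ge> 0\<close> in auto)
  \<comment> \<open>The interval was extended to \<open>t + 1\<close> to keep \<open>t\<close> away
    from its right end.\<close>
  moreover have "at t within {0..t + 1} = at t within {0..}"
    by (rule at_within_nhd[of _ "{..<t + 1}"]) auto
  ultimately show ?thesis by (simp add: has_real_derivative_iff_has_vector_derivative)
qed

lemma disc_0 [simp]: "disc p x 0 = 0"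
  by (simp add: discounted_reward_def)

lemma disc_add:
  assumes p: "policy U p" and "0 \<le> s" "0 \<le> t"
  shows "disc p x (s + t) = disc p x s + \<gamma> powr s * disc p (X p x s) t"
proof -
  let ?R = "\<lambda>x t. \<gamma> powr t * r (X p x t) (p (X p x t))"
  have "integral {s..s + t} (?R x) = integral {0..t} (?R x \<circ> (+) s)"
    using integral_shift_Icc_real[of 0 t "?R x" s] by (simp add: add.commute)
  also have "\<dots> = integral {0..t} (\<lambda>\<tau>. \<gamma> powr s * ?R (X p x s) \<tau>)"
    by (rule integral_cong) (simp add: traj_add[OF p \<open>0 \<le> s\<close>] powr_add)
  also have "\<dots> = \<gamma> powr s * disc p (X p x s) t" by (simp add: discounted_reward_def)
  finally have "integral {s..s + t} (?R x) = \<gamma> powr s * disc p (X p x s) t" .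
  moreover have "?R x integrable_on {0..s + t}"
    by (rule integrable_continuous_real, rule continuous_on_subset[OF reward_cont[OF p]]) auto
  from Henstock_Kurzweil_Integration.integral_combine[OF _ _ this, of s]
  have "disc p x (s + t) = disc p x s + integral {s..s + t} (?R x)"
    using assms by (simp add: discounted_reward_def)
  ultimately show ?thesis by simp
qed

lemma value_along_traj_deriv:
  assumes p: "policy U p" and w: "\<And>x. (w has_derivative (\<lambda>h. grad w x \<bullet> h)) (at x)" and "t \<ge> 0"
  shows "((\<lambda>t. disc p x t + \<gamma> powr t * w (X p x t)) has_real_derivative
     \<gamma> powr t * (ham (X p x t) (p (X p x t)) (grad w (X p x t)) + ln \<gamma> * w (X p x t))) (at t within {0..})"
proof -
  let ?y = "X p x t"
  have "(X p x has_derivative (\<lambda>s. s *\<^sub>R f ?y (p ?y))) (at t within {0..})"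
    using traj_deriv[OF p \<open>t \<ge> 0\<close>] by (simp add: has_vector_derivative_def)
  from has_derivative_compose[OF this w]
  have "((\<lambda>t. w (X p x t)) has_real_derivative grad w ?y \<bullet> f ?y (p ?y)) (at t within {0..})"
    by (simp add: has_field_derivative_def mult_commute_abs)
  moreover have "((\<lambda>t. \<gamma> powr t) has_real_derivative ln \<gamma> * \<gamma> powr t) (at t within {0..})"
    by (rule powr_deriv)
  ultimately have "((\<lambda>t. disc p x t + \<gamma> powr t * w (X p x t)) has_real_derivative
      \<gamma> powr t * r ?y (p ?y) + (ln \<gamma> * \<gamma> powr t * w ?y + grad w ?y \<bullet> f ?y (p ?y) * \<gamma> powr t))
      (at t within {0..})"
    by (intro DERIV_add DERIV_mult disc_deriv[OF p \<open>t \<ge> 0\<close>])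
  then show ?thesis by (rule back_subst) (simp add: hamiltonian_def algebra_simps)
qed

text \<open>\<open>\<gamma> powr t * \<kappa>\<close> is the discounted reward from time
  \<open>t\<close> on at the constant rate \<open>- ln \<gamma> * \<kappa>\<close>, which bounds
  every actual rate. This optimistic estimate of the total can only shrink as actual rewards replace
  it.\<close>

lemma disc_antimono:
  assumes p: "policy U p" and "0 \<le> s" "s \<le> t"
  shows "disc p x t + \<gamma> powr t * \<kappa> \<le> disc p x s + \<gamma> powr s * \<kappa>"
proof -
  let ?D = "\<lambda>t. \<gamma> powr t * (r (X p x t) (p (X p x t)) + ln \<gamma> * \<kappa>)"
  have "((\<lambda>t. - (disc p x t + \<gamma> powr t * \<kappa>)) has_real_derivative - ?D t) (at t within {0..})"
    if "t \<ge> 0" for t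
  proof -
    have "((\<lambda>t. \<gamma> powr t * \<kappa>) has_real_derivative \<gamma> powr t * (ln \<gamma> * \<kappa>)) (at t within {0..})"
      using DERIV_cmult_right[OF powr_deriv, of \<kappa>] by (simp add: ac_simps)
    from DERIV_minus[OF DERIV_add[OF disc_deriv[OF p that] this]]
    show ?thesis by (simp add: algebra_simps)
  qed
  moreover have "0 \<le> - ?D t" for t
    using r_le[of "p (X p x t)" "X p x t"] p by (auto simp: policy_def mult_le_0_iff)
  ultimately show ?thesis
    using nonneg_derivative_imp_mono[of "\<lambda>t. - (disc p x t + \<gamma> powr t * \<kappa>)" "\<lambda>t. - ?D t" s t] assms
    by force
qed

lemma disc_tendsto:
  assumes p: "policy U p" and "\<And>t. t \<ge> 0 \<Longrightarrow> B \<le> disc p x t + \<gamma> powr t * \<kappa>"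
  shows "\<exists>L\<ge>B. (disc p x \<longlongrightarrow> L) at_top"
proof -
  obtain L where L: "((\<lambda>t. disc p x t + \<gamma> powr t * \<kappa>) \<longlongrightarrow> L) at_top"
    using antimono_bounded_tendsto[of "\<lambda>t. disc p x t + \<gamma> powr t * \<kappa>" B] disc_antimono[OF p] assms(2)
    by blast
  have "B \<le> L"
    by (rule tendsto_lowerbound[OF L])
       (use assms(2) in \<open>auto intro: eventually_mono[OF eventually_ge_at_top[of 0]]\<close>)
  moreover have "(disc p x \<longlongrightarrow> L) at_top" using tendsto_diff[OF L \<kappa>_tendsto] by simp
  ultimately show ?thesis by blast
qed

text \<open>The optimistic estimate equals \<open>\<kappa>\<close> at time 0 and decreases to
  \<open>L\<close>. This bound, free of the policy, later makes the supremum of the values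
  finite.\<close>

lemma disc_limit_le:
  assumes p: "policy U p" and L: "(disc p x \<longlongrightarrow> L) at_top"
  shows "L \<le> \<kappa>"
proof (rule tendsto_upperbound)
  show "((\<lambda>t. disc p x t + \<gamma> powr t * \<kappa>) \<longlongrightarrow> L) at_top" using tendsto_add[OF L \<kappa>_tendsto] by simp
  show "\<forall>\<^sub>F t in at_top. disc p x t + \<gamma> powr t * \<kappa> \<le> \<kappa>"
    using eventually_ge_at_top[of 0]
    by eventually_elim (use disc_antimono[OF p, of 0] \<gamma>_pos in fastforce)
qed simp

lemma DPI_evaluation:
  assumes p: "policy U p" and C1: "C1_on UNIV w"
    and eq: "\<And>x. - ln \<gamma> * w x = ham x (p x) (grad w x)"
    and lim: "((\<lambda>t. \<gamma> powr t * w (X p x t)) \<longlongrightarrow> 0) at_top"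
  shows "(disc p x \<longlongrightarrow> w x) at_top"
proof -
  let ?G = "\<lambda>t. disc p x t + \<gamma> powr t * w (X p x t)"
  have "(w has_derivative (\<lambda>h. grad w x \<bullet> h)) (at x)" for x
    using C1_on_has_derivative[OF C1] by simp
  from value_along_traj_deriv[OF p this]
  have G: "(?G has_real_derivative 0) (at t within {0..})" if "t \<ge> 0" for t
    using that by (simp flip: eq)
  \<comment> \<open>A zero derivative makes both \<open>?G\<close> and its negative nondecreasing,
    hence \<open>?G\<close> constant.\<close>
  have "?G t = w x" if "t \<ge> 0" for t
  proof -
    have "?G 0 \<le> ?G t" by (rule nonneg_derivative_imp_mono[OF G]) (use that in auto)
    moreover have "- ?G 0 \<le> - ?G t"
      by (rule nonneg_derivative_imp_mono[OF DERIV_minus[OF G]]) (use that in auto)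
    ultimately show ?thesis using traj_0[OF p] \<gamma>_pos by simp
  qed
  then have "(?G \<longlongrightarrow> w x) at_top"
    by (intro tendsto_eventually eventually_mono[OF eventually_ge_at_top[of 0]])
  from tendsto_diff[OF this lim] show ?thesis by simp
qed

text \<open>Iterating the integral equation identifies the limit along multiples of
  \<open>\<eta>\<close>, and \<open>disc_antimono\<close> extends it to all times. The value so
  obtained satisfies the integral equation for every horizon, and differentiating at time 0 yields
  the differential one.\<close>

lemma IPI_evaluation:
  assumes p: "policy U p" and C1: "C1_on UNIV w" and "\<eta> > 0"
    and eq: "\<And>x. w x = disc p x \<eta> + \<gamma> powr \<eta> * w (X p x \<eta>)"
    and lim: "\<And>x. ((\<lambda>t. \<gamma> powr t * w (X p x t)) \<longlongrightarrow> 0) at_top"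
  shows "(disc p x \<longlongrightarrow> w x) at_top" and "- ln \<gamma> * w x = ham x (p x) (grad w x)"
proof -
  have conv: "(disc p x \<longlongrightarrow> w x) at_top" for x
  proof -
    have iter: "w x = disc p x (real n * \<eta>) + \<gamma> powr (real n * \<eta>) * w (X p x (real n * \<eta>))" for n
    proof (induction n)
      case 0
      then show ?case using traj_0[OF p] \<gamma>_pos by simp
    next
      case (Suc n)
      define s where "s = real n * \<eta>"
      have Suc_n: "real (Suc n) * \<eta> = s + \<eta>" by (simp add: s_def algebra_simps)
      have "0 \<le> s" "0 \<le> \<eta>" using \<open>\<eta> > 0\<close> by (auto simp: s_def)
      note adds = disc_add[OF p this] traj_add[OF p this]
      have "w x = disc p x s + \<gamma> powr s * (disc p (X p x s) \<eta> + \<gamma> powr \<eta> * w (X p (X p x s) \<eta>))"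
        using Suc.IH eq[of "X p x s"] by (simp add: s_def)
      then show ?case unfolding Suc_n adds by (simp add: powr_add algebra_simps)
    qed
    have seq: "filterlim (\<lambda>n. real n * \<eta>) at_top sequentially"
      using \<open>\<eta> > 0\<close> filterlim_real_sequentially by (intro filterlim_at_top_mult_tendsto_pos) auto
    have "disc p x (real n * \<eta>) = w x - \<gamma> powr (real n * \<eta>) * w (X p x (real n * \<eta>))" for n
      using iter[of n] by linarith
    moreover have "(\<lambda>n. w x - \<gamma> powr (real n * \<eta>) * w (X p x (real n * \<eta>))) \<longlonglongrightarrow> w x - 0"
      by (intro tendsto_diff tendsto_const filterlim_compose[OF lim seq])
    ultimately have D: "(\<lambda>n. disc p x (real n * \<eta>)) \<longlonglongrightarrow> w x"
      by simp
    from tendsto_add[OF this filterlim_compose[OF \<kappa>_tendsto seq]]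
    have E: "(\<lambda>n. disc p x (real n * \<eta>) + \<gamma> powr (real n * \<eta>) * \<kappa>) \<longlonglongrightarrow> w x" by simp
    \<comment> \<open>Beyond \<open>t\<close>, the corrected rewards at multiples of
      \<open>\<eta>\<close> lie below the one at \<open>t\<close> and tend to
      \<open>w x\<close>.\<close>
    have "w x \<le> disc p x t + \<gamma> powr t * \<kappa>" if "t \<ge> 0" for t
    proof (rule tendsto_upperbound[OF E])
      have "\<forall>\<^sub>F n in sequentially. t \<le> real n * \<eta>"
        using seq by (simp add: filterlim_at_top)
      then show "\<forall>\<^sub>F n in sequentially. disc p x (real n * \<eta>) + \<gamma> powr (real n * \<eta>) * \<kappa>
          \<le> disc p x t + \<gamma> powr t * \<kappa>"
        by eventually_elim (use disc_antimono[OF p that] in blast)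
    qed simp
    from disc_tendsto[OF p this] obtain L where L: "(disc p x \<longlongrightarrow> L) at_top" by blast
    from filterlim_compose[OF L seq] have "L = w x" using D LIMSEQ_unique by blast
    with L show ?thesis by simp
  qed
  then show "(disc p x \<longlongrightarrow> w x) at_top" .
  let ?G = "\<lambda>t. disc p x t + \<gamma> powr t * w (X p x t)"
  \<comment> \<open>The total reward, started at time \<open>s\<close>, is computed in two ways:
    directly and by splitting at \<open>s\<close>.\<close>
  have const: "?G s = w x" if "s \<ge> 0" for s
  proof -
    have "((\<lambda>t. disc p x (s + t)) \<longlongrightarrow> w x) at_top"
      by (rule filterlim_compose[OF conv filterlim_tendsto_add_at_top[OF tendsto_const filterlim_ident]])
    moreover have "((\<lambda>t. disc p x s + \<gamma> powr s * disc p (X p x s) t) \<longlongrightarrow> ?G s) at_top"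
      by (intro tendsto_intros conv)
    then have "((\<lambda>t. disc p x (s + t)) \<longlongrightarrow> ?G s) at_top"
      by (rule Lim_transform_eventually)
         (use that in \<open>auto intro: eventually_mono[OF eventually_ge_at_top[of 0]] simp: disc_add[OF p]\<close>)
    ultimately show ?thesis using tendsto_unique trivial_limit_at_top_linorder by blast
  qed
  have "(w has_derivative (\<lambda>h. grad w x \<bullet> h)) (at x)" for x
    using C1_on_has_derivative[OF C1] by simp
  from value_along_traj_deriv[OF p this, of 0 x]
  have "(?G has_real_derivative ham x (p x) (grad w x) + ln \<gamma> * w x) (at 0 within {0..})"
    using traj_0[OF p] \<gamma>_pos by simp
  \<comment> \<open>Constancy is known for nonnegative times only, so the two derivatives are
    compared from the right.\<close>
  moreover have "(?G has_real_derivative 0) (at 0 within {0..})"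
    by (rule has_field_derivative_transform_within[where d = 1 and f = "\<lambda>_. w x"])
       (use const in auto)
  ultimately have "ham x (p x) (grad w x) + ln \<gamma> * w x = 0"
    unfolding has_real_derivative_iff_has_vector_derivative
    by (rule vector_derivative_unique_within[rotated]) (simp add: at_within_Ici_at_right)
  then show "- ln \<gamma> * w x = ham x (p x) (grad w x)" by simp
qed

text \<open>No decay of \<open>w\<close> along the trajectories of the new policy \<open>q\<close>
  is known here. The bound \<open>w \<le> \<kappa>\<close> takes its place: it turns monotonicity of
  \<open>?G\<close> into a lower bound for the corrected reward, which forces convergence.\<close>

lemma policy_improvement_ge:
  assumes imp: "policy_improvement f r U w q" and C1: "C1_on UNIV w" and p: "policy U p"
    and eq: "\<And>x. - ln \<gamma> * w x = ham x (p x) (grad w x)" and le: "\<And>x. w x \<le> \<kappa>"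
  shows "\<exists>L\<ge>w x. (disc q x \<longlongrightarrow> L) at_top"
proof (rule disc_tendsto)
  show q: "policy U q" using imp by (simp add: policy_improvement_def)
  fix t :: real assume "t \<ge> 0"
  let ?G = "\<lambda>t. disc q x t + \<gamma> powr t * w (X q x t)"
  have "ham x (p x) (grad w x) \<le> ham x (q x) (grad w x)" for x
    using imp p unfolding policy_improvement_def policy_def is_arg_max_linorder by blast
  then have "0 \<le> ham x (q x) (grad w x) + ln \<gamma> * w x" for x
    using eq[of x] by (smt (verit) mult_minus_left)
  moreover have "(w has_derivative (\<lambda>h. grad w x \<bullet> h)) (at x)" for x
    using C1_on_has_derivative[OF C1] by simp
  ultimately have "?G 0 \<le> ?G t"
    by (intro nonneg_derivative_imp_mono[OF value_along_traj_deriv[OF q]]) (use \<open>t \<ge> 0\<close> in auto)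
  moreover have "\<gamma> powr t * w (X q x t) \<le> \<gamma> powr t * \<kappa>" by (intro mult_left_mono le) auto
  moreover have "?G 0 = w x" using traj_0[OF q] \<gamma>_pos by simp
  ultimately show "w x \<le> disc q x t + \<gamma> powr t * \<kappa>" by linarith
qed

end

subsection \<open>Convergence of policy iteration\<close>

theorem theorem5p1:
  fixes f :: "real ^ 'l \<Rightarrow> real ^ 'm \<Rightarrow> real ^ 'l"
    and r :: "real ^ 'l \<Rightarrow> real ^ 'm \<Rightarrow> real"
    and U :: "(real ^ 'm) set"
    and \<gamma> \<alpha> rmax :: real
    and fd :: "real ^ 'l \<Rightarrow> real ^ 'l"
    and Fc :: "real ^ 'l \<Rightarrow> real ^ 'm ^ 'l"
    and rr :: "real ^ 'l \<Rightarrow> real"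
    and c :: "real ^ 'm \<Rightarrow> real"
    and v :: "nat \<Rightarrow> real ^ 'l \<Rightarrow> real"
    and \<pi> :: "nat \<Rightarrow> real ^ 'l \<Rightarrow> real ^ 'm"
    and vs :: "real ^ 'l \<Rightarrow> real"
    and \<sigma> :: "real ^ 'm \<Rightarrow> real ^ 'm"
    and \<pi>s :: "real ^ 'l \<Rightarrow> real ^ 'm"
  assumes "action_space U"
    and "continuous_on (UNIV \<times> U) (\<lambda>(x, u). f x u)"
    and "continuous_on (UNIV \<times> U) (\<lambda>(x, u). r x u)"
    and "well_posed f U"
    and "0 < \<gamma>" and "\<gamma> \<le> 1" and "\<alpha> = - ln \<gamma>"
    and "is_maximum (\<lambda>(x, u). r x u) (UNIV \<times> U) rmax" and "\<gamma> = 1 \<Longrightarrow> rmax = 0"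
    and "\<exists>p. admissible f r U \<gamma> p"
    and "\<And>p. admissible f r U \<gamma> p \<Longrightarrow>
              C1_on UNIV (\<lambda>x. real_of_ereal (value_function f r \<gamma> p x))"
    and "\<And>x u. u \<in> U \<Longrightarrow> f x u = fd x + Fc x *v u"
    and "continuous_on UNIV fd" and "continuous_on UNIV Fc"
    and "\<And>x u. u \<in> U \<Longrightarrow> r x u = rr x - c u"
    and "continuous_on UNIV rr"
    and "strictly_convex_on U c" and "C1_on U c" and "grad c ` interior U = UNIV"
    and "DPI f r U \<gamma> v \<pi> \<or> (\<exists>\<eta>>0. IPI f r U \<gamma> \<eta> v \<pi>)"
    and "\<And>i x. i \<ge> 1 \<Longrightarrow> admissible f r U \<gamma> (\<pi> (i - 1)) \<Longrightarrow>
              ((\<lambda>t. \<gamma> powr t * v i (traj f (\<pi> (i - 1)) x t)) \<longlongrightarrow> 0) at_top"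
    and "\<exists>g. locally_uniform_limit (\<lambda>i. grad (v i)) g"
    and "vs = (\<lambda>x. SUP i\<in>{1..}. v i x)"
    and "\<sigma> = inv_into (interior U) (grad c)"
    and "\<pi>s = (\<lambda>x. \<sigma> (transpose (Fc x) *v grad vs x))"
  shows "(\<forall>x. bdd_above ((\<lambda>i. v i x) ` {1..}))
    \<and> (\<forall>x. is_maximum (\<lambda>u. hamiltonian f r x u (grad vs x)) U (\<alpha> * vs x))
    \<and> C1_on UNIV vs
    \<and> locally_uniform_limit v vs
    \<and> locally_uniform_limit (\<lambda>i. grad (v i)) (grad vs)
    \<and> locally_uniform_limit \<pi> \<pi>s
    \<and> bij_betw (grad c) (interior U) UNIV
    \<and> (\<forall>p. (\<forall>x. is_arg_max (\<lambda>u. hamiltonian f r x u (grad vs x)) (\<lambda>u. u \<in> U) (p x))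
            \<longleftrightarrow> p = \<pi>s)"
proof -
  note \<gamma>_pos = assms(5) and f = assms(12) and r = assms(15) and c = assms(17-19)
  define \<kappa> where "\<kappa> = (if \<gamma> = 1 then 0 else rmax / - ln \<gamma>)"
  have max_r: "r x u \<le> rmax" if "u \<in> U" for x u
    using assms(8) that by (auto simp: is_maximum_def)
  interpret control_problem f r U \<gamma> \<kappa>
  proof
    show "r x u \<le> - ln \<gamma> * \<kappa>" if "u \<in> U" for x u
      using max_r[OF that, of x] assms(9) \<gamma>_pos by (cases "\<gamma> = 1") (auto simp: \<kappa>_def)
    show "((\<lambda>t. \<gamma> powr t * \<kappa>) \<longlongrightarrow> 0) at_top"
    proof (cases "\<gamma> = 1")
      case False
      then have "0 < - ln \<gamma>" using assms(5,6) by simp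
      then have "filterlim (\<lambda>t. - ln \<gamma> * t) at_top at_top"
        by (intro filterlim_tendsto_pos_mult_at_top[OF tendsto_const _ filterlim_ident])
      then have "((\<lambda>t. exp (- (- ln \<gamma> * t))) \<longlongrightarrow> 0) at_top"
        by (intro filterlim_compose[OF exp_at_bot]) (simp add: filterlim_uminus_at_top)
      then have "((\<lambda>t. \<gamma> powr t) \<longlongrightarrow> 0) at_top"
        using \<gamma>_pos by (simp add: powr_def mult.commute)
      then show ?thesis by (rule tendsto_mult_left_zero)
    qed (simp add: \<kappa>_def)
  qed (use assms(3,4,5) in auto)

  have C1: "C1_on UNIV (v (Suc i))" and imp: "policy_improvement f r U (v (Suc i)) (\<pi> (Suc i))" for i
    using assms(20) by (auto simp: DPI_def IPI_def)
  \<comment> \<open>\<open>v (Suc i)\<close> evaluates \<open>\<pi> i\<close>. From here on both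
    algorithms are treated alike, each supplying the value and the differential equation.\<close>
  have eval: "(disc (\<pi> i) x \<longlongrightarrow> v (Suc i) x) at_top"
    "- ln \<gamma> * v (Suc i) x = ham x (\<pi> i x) (grad (v (Suc i)) x)"
    if adm: "admissible f r U \<gamma> (\<pi> i)" for i x
  proof -
    have p: "policy U (\<pi> i)" using adm by (simp add: admissible_def)
    have lim: "((\<lambda>t. \<gamma> powr t * v (Suc i) (X (\<pi> i) x t)) \<longlongrightarrow> 0) at_top" for x
      using assms(21)[of "Suc i"] adm by simp
    have "(disc (\<pi> i) x \<longlongrightarrow> v (Suc i) x) at_top \<and>
        - ln \<gamma> * v (Suc i) x = ham x (\<pi> i x) (grad (v (Suc i)) x)"
      using assms(20)
    proof
      assume "DPI f r U \<gamma> v \<pi>"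
      then have "- ln \<gamma> * v (Suc i) x = ham x (\<pi> i x) (grad (v (Suc i)) x)" for x
        unfolding DPI_def by (metis diff_Suc_1 le_add1 plus_1_eq_Suc)
      with DPI_evaluation[OF p C1 this lim] show ?thesis by blast
    next
      assume "\<exists>\<eta>>0. IPI f r U \<gamma> \<eta> v \<pi>"
      then obtain \<eta> where "\<eta> > 0" and "\<And>x. v (Suc i) x =
          disc (\<pi> i) x \<eta> + \<gamma> powr \<eta> * v (Suc i) (X (\<pi> i) x \<eta>)"
        unfolding IPI_def by (metis diff_Suc_1 le_add1 plus_1_eq_Suc)
      with IPI_evaluation[OF p C1 this lim] show ?thesis by blast
    qed
    then show "(disc (\<pi> i) x \<longlongrightarrow> v (Suc i) x) at_top"
      "- ln \<gamma> * v (Suc i) x = ham x (\<pi> i x) (grad (v (Suc i)) x)" by auto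
  qed
  have bound: "v (Suc i) x \<le> \<kappa>" if "admissible f r U \<gamma> (\<pi> i)" for i x
    using disc_limit_le[OF _ eval(1)[OF that]] that by (simp add: admissible_def)
  have step: "\<exists>L\<ge>v (Suc i) x. (disc (\<pi> (Suc i)) x \<longlongrightarrow> L) at_top"
    if "admissible f r U \<gamma> (\<pi> i)" for i x
    using that
    by (intro policy_improvement_ge[OF imp C1 _ eval(2)[OF that] bound[OF that]]) (simp add: admissible_def)
  \<comment> \<open>The boundary condition is available only for admissible policies, so evaluation
    and admissibility advance together: \<open>step\<close> supplies a finite value for the next
    policy.\<close>
  have adm: "admissible f r U \<gamma> (\<pi> i)" for i
  proof (induction i)
    case 0
    then show ?case using assms(20) by (auto simp: DPI_def IPI_def)
  next
    case (Suc i)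
    have "\<bar>value_function f r \<gamma> (\<pi> (Suc i)) x\<bar> \<noteq> \<infinity>" for x
      using step[OF Suc.IH, of x] tendsto_imp_value_function by fastforce
    then show ?case using imp by (simp add: admissible_def policy_improvement_def)
  qed
  \<comment> \<open>\<open>step\<close> bounds the limiting reward of \<open>\<pi> (Suc i)\<close>
    below by \<open>v (Suc i) x\<close>; evaluation identifies that limit as
    \<open>v (Suc (Suc i)) x\<close>.\<close>
  have "incseq (\<lambda>i. v (Suc i) x)" for x
  proof (rule incseq_SucI)
    fix i
    obtain L where "v (Suc i) x \<le> L" "(disc (\<pi> (Suc i)) x \<longlongrightarrow> L) at_top"
      using step[OF adm] by blast
    with eval(1)[OF adm, of "Suc i" x] show "v (Suc i) x \<le> v (Suc (Suc i)) x"
      using tendsto_unique trivial_limit_at_top_linorder by blast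
  qed
  moreover have "{1..} = range Suc" by (simp add: atLeast_Suc_greaterThan greaterThan_0)
  then have img: "(\<lambda>i. v i x) ` {1..} = range (\<lambda>i. v (Suc i) x)" for x
    by (simp only: image_image)
  moreover have bdd: "bdd_above (range (\<lambda>i. v (Suc i) x))" for x
    using bound[OF adm] by (intro bdd_aboveI2)
  ultimately have vS: "(\<lambda>i. v (Suc i) x) \<longlonglongrightarrow> vs x" for x
    unfolding assms(23) by (metis LIMSEQ_incseq_SUP)
  then have v_lim: "(\<lambda>i. v i x) \<longlonglongrightarrow> vs x" for x
    by (rule filterlim_sequentially_Suc[THEN iffD1])

  have C1': "C1_on UNIV (v i)" if "i \<ge> 1" for i
    using C1[of "i - 1"] that by simp
  obtain G where G: "locally_uniform_limit (\<lambda>i. grad (v i)) G" using assms(22) by blast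
  have "\<forall>\<^sub>F i in sequentially. continuous_on UNIV (grad (v i))"
    using eventually_ge_at_top[of 1] by eventually_elim (use C1' in \<open>auto simp: C1_on_def\<close>)
  then have G_cont: "continuous_on UNIV G" by (rule locally_uniform_limit_continuous[OF G])
  note vs_lim = locally_uniform_limit_grad(1)[OF C1' G v_lim]
  note vs_deriv = locally_uniform_limit_grad(2)[OF C1' G v_lim]
  have grad_vs: "grad vs = G" using has_derivative_imp_grad_eq[OF vs_deriv] by blast
  have vs_C1: "C1_on UNIV vs" using vs_deriv G_cont by (rule C1_onI)

  \<comment> \<open>Kept general in \<open>q\<close>, this serves the iterates with
    \<open>grad (v i) x\<close> and the limit with \<open>grad vs x\<close>, and it also gives
    uniqueness of \<open>\<pi>s\<close>.\<close>
  have arg_max: "is_arg_max (\<lambda>u. ham x u q) (\<lambda>u. u \<in> U) u \<longleftrightarrow> u = \<sigma> (transpose (Fc x) *v q)" for x q u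
    unfolding assms(24) by (rule input_affine_is_arg_max_iff[where fd = fd and rr = rr, OF _ _ c])
       (auto intro: f r)
  have \<pi>s_max: "is_arg_max (\<lambda>u. ham x u (grad vs x)) (\<lambda>u. u \<in> U) (\<pi>s x)" for x
    by (simp add: arg_max assms(25))
  have \<pi>_eq: "(\<lambda>x. \<sigma> (transpose (Fc x) *v grad (v i) x)) = \<pi> i" if "i \<ge> 1" for i
  proof
    show "\<sigma> (transpose (Fc x) *v grad (v i) x) = \<pi> i x" for x
      using imp[of "i - 1"] that arg_max[of x "grad (v i) x" "\<pi> i x"]
      by (simp add: policy_improvement_def)
  qed
  \<comment> \<open>Joint continuity in the state and the gradient lets the locally uniform limit
    pass through \<sigma>.\<close>
  have "continuous_on UNIV (\<lambda>z. transpose (Fc (fst z)) *v snd z :: real ^ 'm)"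
    unfolding matrix_vector_mult_def transpose_def
    by (simp, intro continuous_intros continuous_on_compose2[OF assms(14)]) auto
  then have "continuous_on UNIV (\<lambda>z. \<sigma> (transpose (Fc (fst z)) *v snd z))"
    unfolding assms(24) by (rule continuous_on_compose2[OF continuous_on_inv_grad[OF c]]) auto
  from locally_uniform_limit_compose[OF G G_cont this]
  have "locally_uniform_limit (\<lambda>i x. \<sigma> (transpose (Fc x) *v grad (v i) x)) \<pi>s"
    by (simp add: assms(25) grad_vs)
  then have \<pi>_lim: "locally_uniform_limit \<pi> \<pi>s"
    by (rule locally_uniform_limit_cong)
       (rule eventually_mono[OF eventually_ge_at_top[of 1]], rule \<pi>_eq)

  \<comment> \<open>The Hamiltonians pair \<open>\<pi> i\<close> with the gradient of the next
    function \<open>v (Suc i)\<close>. Their limit is computed once by continuity and once from the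
    evaluation equation.\<close>
  have HJB: "\<alpha> * vs x = ham x (\<pi>s x) (grad vs x)" for x
  proof (rule LIMSEQ_unique)
    have \<pi>_x: "(\<lambda>i. \<pi> i x) \<longlonglongrightarrow> \<pi>s x" by (rule locally_uniform_limit_imp_tendsto[OF \<pi>_lim])
    have grad_x: "(\<lambda>i. grad (v (Suc i)) x) \<longlonglongrightarrow> grad vs x"
      unfolding grad_vs by (rule LIMSEQ_Suc[OF locally_uniform_limit_imp_tendsto[OF G]])
    have U: "\<pi>s x \<in> U" "\<And>i. \<pi> i x \<in> U"
      using \<pi>s_max adm by (auto simp: is_arg_max_def admissible_def policy_def)
    \<comment> \<open>Continuity of \<open>f\<close> and \<open>r\<close> is available on
      \<open>U\<close> only, so the limit action must itself belong to \<open>U\<close>.\<close>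
    have "continuous_on U (Pair x)" "Pair x ` U \<subseteq> UNIV \<times> U"
      using continuous_on_Pair[OF continuous_on_const continuous_on_id, of U x] by auto
    then have "continuous_on U (f x)" "continuous_on U (r x)"
      using continuous_on_compose2[OF assms(2)] continuous_on_compose2[OF assms(3)] by fastforce+
    then have "(\<lambda>i. f x (\<pi> i x)) \<longlonglongrightarrow> f x (\<pi>s x)" "(\<lambda>i. r x (\<pi> i x)) \<longlonglongrightarrow> r x (\<pi>s x)"
      by (simp_all add: continuous_on_tendsto_compose[OF _ \<pi>_x U(1)] U(2))
    then show "(\<lambda>i. ham x (\<pi> i x) (grad (v (Suc i)) x)) \<longlonglongrightarrow> ham x (\<pi>s x) (grad vs x)"
      unfolding hamiltonian_def by (intro tendsto_intros grad_x)
    show "(\<lambda>i. ham x (\<pi> i x) (grad (v (Suc i)) x)) \<longlonglongrightarrow> \<alpha> * vs x"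
      unfolding assms(7) eval(2)[OF adm, symmetric] by (intro tendsto_intros vS)
  qed
  have "is_maximum (\<lambda>u. ham x u (grad vs x)) U (\<alpha> * vs x)" for x
    using \<pi>s_max[of x] unfolding is_maximum_def is_arg_max_linorder HJB by blast
  moreover have "(\<forall>x. is_arg_max (\<lambda>u. ham x u (grad vs x)) (\<lambda>u. u \<in> U) (p x)) \<longleftrightarrow> p = \<pi>s" for p
    by (auto simp: arg_max assms(25) fun_eq_iff)
  ultimately show ?thesis
    using img bdd vs_C1 vs_lim G grad_vs \<pi>_lim strictly_convex_on_bij_betw_grad[OF c] by auto
qed

end
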